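(* Let $m\geq 4$ be even, and let $e$ be an integer with $2 \leq e \leq m/2$ and $\gcd(m,e)=2$. Let $\alpha$ be a generator of $\mathbb{F}_{2^m}^*$, let $\mathcal{C}_E$ be the binary cyclic code of length $2^m-1$ with generator polynomial $\operatorname{lcm}\big(\mathbb{M}_{\alpha}(x),\mathbb{M}_{\alpha^{1+2^e}}(x)\big)$, and let $\overline{\mathcal{C}_E}$ be its extended code, with coordinates indexed by $V=\{0,1,\dots,2^m-1\}$. Then the supports of the codewords of Hamming weight $4$ in $\overline{\mathcal{C}_E}$ form a $2$-$(2^m,4,1)$ design on $V$, i.e., a Steiner system $S(2,4,2^m)$.
   Context: $\mathbb{M}_{\beta}(x)$ denotes the minimal polynomial of $\beta\in\mathbb{F}_{2^m}$ over $\mathbb{F}_2$. A binary cyclic code of length $n$ with generator polynomial $g(x)$ is the ideal generated by $g(x)$ in $\mathbb{F}_2[x]/(x^n-1)$, identified with vectors in $\mathbb{F}_2^n$. The extended code is obtained by appending an overall parity-check coordinate (sum of all coordinates) to each codeword. The support of a codeword is the set of coordinates where it is nonzero. A $2$-$(v,k,\lambda)$ design is a pair $(V,\mathcal{B})$ with $|V|=v$ and $\mathcal{B}$ a set of $k$-subsets of $V$ such that every $2$-subset of $V$ is contained in exactly $\lambda$ members of $\mathcal{B}$; a $2$-$(v,k,1)$ design is a Steiner system $S(2,k,v)$. *)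

theory Defs
  imports
    "HOL-Library.Z2"
    "HOL-Library.Cardinality"
    "HOL-Computational_Algebra.Computational_Algebra"
    "HOL-Computational_Algebra.Field_as_Ring"
    "HOL-Number_Theory.Cong"
begin

text \<open>
  The field $\mathbb{F}_2$ is the library type \<^typ>\<open>bit\<close>. The instances below make the
  library operation \<^const>\<open>lcm\<close> (monic on nonzero arguments) available on \<^typ>\<open>bit poly\<close>.
  The operation \<open>mod\<close> on \<^typ>\<open>bit\<close> is already fixed in \<^theory>\<open>HOL-Library.Z2\<close>.
\<close>

instantiation bit ::
  "{unique_euclidean_ring, normalization_euclidean_semiring, normalization_semidom_multiplicative}"
begin

definition [simp]: "normalize_bit = (normalize_field :: bit \<Rightarrow> _)"
definition [simp]: "unit_factor_bit = (unit_factor_field :: bit \<Rightarrow> _)"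
definition [simp]: "euclidean_size_bit = (euclidean_size_field :: bit \<Rightarrow> _)"
definition [simp]: "division_segment (x :: bit) = 1"

instance
proof
  fix a b c :: bit
  show "euclidean_size (a mod b) < euclidean_size b" if "b \<noteq> 0"
    using that by simp
  show "(q * b + r) div b = q"
    if "b \<noteq> 0" "division_segment r = division_segment b" "euclidean_size r < euclidean_size b"
    for q r :: bit
    using that by (cases q; cases r) (auto split: if_splits)
qed (auto simp: dvd_field_iff split: if_splits)

end

instantiation bit :: euclidean_ring_gcd
begin

definition gcd_bit :: "bit \<Rightarrow> bit \<Rightarrow> bit" where
  "gcd_bit = Euclidean_Algorithm.gcd"
definition lcm_bit :: "bit \<Rightarrow> bit \<Rightarrow> bit" where
  "lcm_bit = Euclidean_Algorithm.lcm"
definition Gcd_bit :: "bit set \<Rightarrow> bit" where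
  "Gcd_bit = Euclidean_Algorithm.Gcd"
definition Lcm_bit :: "bit set \<Rightarrow> bit" where
  "Lcm_bit = Euclidean_Algorithm.Lcm"

instance
  by standard (simp_all add: gcd_bit_def lcm_bit_def Gcd_bit_def Lcm_bit_def)

end

instance bit :: field_gcd ..

text \<open>
  \<open>map_poly of_bit\<close> views a polynomial over $\mathbb{F}_2$ as one over the extension; \<open>of_bit\<close>
  is the embedding of $\mathbb{F}_2$ only when the target field has characteristic 2.
\<close>

definition is_min_poly :: "'a::field \<Rightarrow> bit poly \<Rightarrow> bool" where
  "is_min_poly \<beta> p \<longleftrightarrow>
     lead_coeff p = 1 \<and> poly (map_poly of_bit p) \<beta> = 0 \<and>
     (\<forall>q. q \<noteq> 0 \<and> poly (map_poly of_bit q) \<beta> = 0 \<longrightarrow> degree p \<le> degree q)"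

definition min_poly :: "'a::field \<Rightarrow> bit poly" where
  "min_poly \<beta> = (THE p. is_min_poly \<beta> p)"

definition generates_units :: "'a::field \<Rightarrow> bool" where
  "generates_units \<alpha> \<longleftrightarrow> range (\<lambda>k::int. \<alpha> powi k) = UNIV - {0}"

text \<open>
  The word $(c_0,\dots,c_{n-1})$ is the list of its coordinates and is identified with the class
  of $c_0 + c_1 x + \dots + c_{n-1} x^{n-1}$ modulo $x^n - 1$.
\<close>

definition cyclic_code :: "nat \<Rightarrow> bit poly \<Rightarrow> bit list set" where
  "cyclic_code n g = {c. length c = n \<and> (\<exists>a. [Poly c = a * g] (mod (monom 1 n - 1)))}"

definition extended_code :: "bit list set \<Rightarrow> bit list set" where
  "extended_code C = (\<lambda>c. c @ [sum_list c]) ` C"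

definition support :: "bit list \<Rightarrow> nat set" where
  "support c = {i. i < length c \<and> c ! i \<noteq> 0}"

definition hamming_weight :: "bit list \<Rightarrow> nat" where
  "hamming_weight c = card (support c)"

text \<open>For \<open>l = 1\<close> this is a Steiner system $S(2,k,v)$.\<close>

definition two_design :: "nat \<Rightarrow> nat \<Rightarrow> nat \<Rightarrow> 'v set \<Rightarrow> 'v set set \<Rightarrow> bool" where
  "two_design v k l V \<B> \<longleftrightarrow>
     finite V \<and> card V = v \<and>
     (\<forall>B\<in>\<B>. B \<subseteq> V \<and> card B = k) \<and>
     (\<forall>P. P \<subseteq> V \<and> card P = 2 \<longrightarrow> card {B \<in> \<B>. P \<subseteq> B} = l)"

end

theory Submission
  imports Defs
begin

text \<open>
  Label the coordinates of the extended code by the elements of $\mathbb{F}_{2^m}$. A word of even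
  weight with support $S$ then lies in the extended code iff $\sum_{t \in S} t = 0$ and
  $\sum_{t \in S} t^{1+Q} = 0$, where $Q = 2^e$. If $|S| = 4$, the first condition means
  $S = \{x, x+u, x+v, x+u+v\}$, and the second sum becomes $u v^Q + u^Q v$. It vanishes iff $v/u$
  is fixed by the $Q$-power map, i.e. lies in
  $\mathbb{F}_{2^{\gcd(m,e)}} = \mathbb{F}_4$. Hence the blocks are the
  sets $x + u\,\mathbb{F}_4$, and $x \ne y$ lie together only in $x + (x+y)\,\mathbb{F}_4$.
\<close>

section \<open>Finite fields of characteristic two\<close>

text \<open>Translation by 1 permutes the field, so comparing the sum of all elements with its
  translate gives \<open>2 ^ m = 0\<close> in the field, and a field has no nonzero
  nilpotents.\<close>

lemma two_eq_zero_of_card: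
  assumes "CARD('a::{field,finite}) = 2 ^ m"
  shows "(2::'a) = 0"
proof -
  have "(\<Sum>x\<in>(UNIV::'a set). x + 1) = (\<Sum>x\<in>(UNIV::'a set). x)"
    by (rule sum.reindex_bij_witness[of _ "\<lambda>x. x - 1" "\<lambda>x. x + 1"]) auto
  hence "of_nat (CARD('a)) = (0::'a)"
    by (simp add: sum.distrib)
  thus ?thesis
    using assms by simp
qed

lemma power_card_minus_one:
  fixes x :: "'a::{field,finite}"
  assumes "x \<noteq> 0"
  shows "x ^ (CARD('a) - 1) = 1"
proof -
  have "(\<Prod>y\<in>UNIV - {0}. x * y) = (\<Prod>y\<in>UNIV - {0::'a}. y)"
    by (rule prod.reindex_bij_witness[of _ "\<lambda>y. y / x" "\<lambda>y. x * y"]) (use assms in auto)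
  hence "x ^ (CARD('a) - 1) * (\<Prod>y\<in>UNIV - {0::'a}. y) = (\<Prod>y\<in>UNIV - {0::'a}. y)"
    by (simp add: prod.distrib card_Diff_singleton)
  moreover have "(\<Prod>y\<in>UNIV - {0::'a}. y) \<noteq> 0"
    by simp
  ultimately show ?thesis
    by simp
qed

lemma generates_units_nonzero:
  assumes "generates_units \<alpha>"
  shows "\<alpha> \<noteq> 0"
proof -
  have "\<alpha> powi 1 \<in> range (\<lambda>k::int. \<alpha> powi k)"
    by (rule rangeI)
  hence "\<alpha> powi 1 \<in> UNIV - {0}"
    using assms unfolding generates_units_def by (simp only:)
  thus ?thesis
    by simp
qed

text \<open>Integer exponents reduce modulo \<open>n\<close> because
  \<open>\<alpha> ^ n = 1\<close>. The resulting surjection goes between sets of equal finite size,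
  so it is injective.\<close>

lemma generator_bij_betw:
  fixes \<alpha> :: "'a::{field,finite}"
  assumes "generates_units \<alpha>"
  shows "bij_betw (\<lambda>i. \<alpha> ^ i) {..<CARD('a) - 1} (UNIV - {0})"
proof -
  define n where "n = CARD('a) - 1"
  have range: "range (\<lambda>k::int. \<alpha> powi k) = UNIV - {0}"
    using assms by (simp add: generates_units_def)
  have nz: "\<alpha> \<noteq> 0"
    using assms by (rule generates_units_nonzero)
  have card: "card (UNIV - {0::'a}) = n"
    by (simp add: n_def card_Diff_singleton)
  have "n > 0"
    using card by (metis DiffI UNIV_I card_gt_0_iff empty_iff finite singletonD zero_neq_one)
  have "x \<in> (\<lambda>i. \<alpha> ^ i) ` {..<n}" if x: "x \<noteq> 0" for x
  proof -
    obtain k :: int where k: "x = \<alpha> powi k"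
      using range x by blast
    have "\<alpha> powi k = \<alpha> powi (int n * (k div int n) + k mod int n)"
      by simp
    also have "\<dots> = (\<alpha> powi int n) powi (k div int n) * \<alpha> powi (k mod int n)"
      using nz by (subst power_int_add) (simp_all only: power_int_mult simp_thms)
    also have "\<alpha> powi int n = 1"
      using power_card_minus_one[OF nz] unfolding n_def power_int_of_nat .
    also have "\<alpha> powi (k mod int n) = \<alpha> ^ nat (k mod int n)"
      using \<open>n > 0\<close> by (simp add: power_int_def)
    finally have "x = \<alpha> ^ nat (k mod int n)"
      using k by simp
    moreover have "nat (k mod int n) < n"
      using \<open>n > 0\<close> by (simp add: nat_less_iff)
    ultimately show ?thesis
      by blast
  qed
  hence image: "(\<lambda>i. \<alpha> ^ i) ` {..<n} = UNIV - {0}"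
    using nz by auto
  moreover have "inj_on (\<lambda>i. \<alpha> ^ i) {..<n}"
    by (rule eq_card_imp_inj_on) (simp_all add: image card)
  ultimately show ?thesis
    by (simp add: bij_betw_def n_def)
qed

lemma char_two_add_self:
  assumes "(2::'a::comm_ring_1) = 0"
  shows "x + x = (0::'a)"
  using assms by (metis mult_2 mult_zero_left)

lemma char_two_neg:
  assumes "(2::'a::comm_ring_1) = 0"
  shows "- x = (x::'a)"
  using char_two_add_self[OF assms] by (simp add: neg_eq_iff_add_eq_0)

lemma char_two_frobenius_add:
  assumes "(2::'a::comm_ring_1) = 0"
  shows "(x + y :: 'a) ^ (2 ^ k) = x ^ (2 ^ k) + y ^ (2 ^ k)"
proof (induction k)
  case (Suc k)
  have "(x + y) ^ (2 ^ Suc k) = ((x + y) ^ (2 ^ k))\<^sup>2"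
    by (simp only: power_Suc2 power_mult)
  also have "\<dots> = (x ^ (2 ^ k) + y ^ (2 ^ k))\<^sup>2"
    by (simp only: Suc.IH)
  also have "\<dots> = (x ^ (2 ^ k))\<^sup>2 + (y ^ (2 ^ k))\<^sup>2"
    by (simp add: power2_sum assms)
  finally show ?case
    by (simp only: power_Suc2 power_mult)
qed simp

text \<open>Euclid's algorithm on the number of squarings: being fixed by \<open>b\<close> squarings
  means being fixed by any multiple of \<open>b\<close>, which can be split off from
  \<open>a\<close> to leave \<open>a mod b\<close>.\<close>

lemma frobenius_fixed_gcd:
  fixes x :: "'a::monoid_mult"
  assumes "x ^ (2 ^ a) = x" and "x ^ (2 ^ b) = x"
  shows "x ^ (2 ^ gcd a b) = x"
  using assms
proof (induction a b rule: gcd_nat_induct)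
  case (step a b)
  have "x ^ (2 ^ (b * k)) = x" for k
    by (induction k) (simp_all add: power_add power_mult step.prems)
  hence "x ^ (2 ^ (a mod b)) = x ^ (2 ^ (b * (a div b) + a mod b))"
    by (simp only: power_add power_mult)
  hence "x ^ (2 ^ (a mod b)) = x"
    by (simp add: step.prems)
  thus ?case
    using step by (simp add: gcd_red_nat[of a b])
qed simp

section \<open>Quadruples with vanishing power sums\<close>

text \<open>The power \<open>2 ^ e\<close> is additive, so each term is a product of two sums. After
  expansion every monomial occurs an even number of times, except the two mixed ones in
  \<open>u\<close> and \<open>v\<close>.\<close>

lemma char_two_plane_sum:
  fixes x u v :: "'a::comm_ring_1"
  assumes "(2::'a) = 0"
  shows "x ^ (1 + 2 ^ e) + (x + u) ^ (1 + 2 ^ e) + (x + v) ^ (1 + 2 ^ e) + (x + u + v) ^ (1 + 2 ^ e)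
       = u * v ^ (2 ^ e) + u ^ (2 ^ e) * v"
proof -
  have "x ^ (1 + 2 ^ e) + (x + u) ^ (1 + 2 ^ e) + (x + v) ^ (1 + 2 ^ e) + (x + u + v) ^ (1 + 2 ^ e)
      = 2 * (2 * x * x ^ 2 ^ e + x * u ^ 2 ^ e + x * v ^ 2 ^ e + u * x ^ 2 ^ e + v * x ^ 2 ^ e
             + u * u ^ 2 ^ e + v * v ^ 2 ^ e) + (u * v ^ 2 ^ e + u ^ 2 ^ e * v)"
    by (simp only: power_add power_one_right char_two_frobenius_add[OF assms])
       (simp add: algebra_simps)
  thus ?thesis
    by (simp add: assms)
qed

text \<open>The element \<open>w\<close> is a primitive cube root of unity, so {0, 1, w, w + 1} is
  the subfield with four elements. The quadruple is the line over this subfield through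
  \<open>x\<close> and \<open>y\<close>.\<close>

lemma char_two_quadruple_unique:
  fixes x y :: "'a::field"
  assumes two: "(2::'a) = 0"
    and frob: "\<And>z::'a. z ^ (2 ^ m) = z"
    and gcd: "gcd m e = 2"
    and w: "w\<^sup>2 + w + 1 = (0::'a)"
    and xy: "x \<noteq> y"
  shows "\<exists>!T. card T = 4 \<and> {x, y} \<subseteq> T \<and> (\<Sum>t\<in>T. t) = 0 \<and> (\<Sum>t\<in>T. t ^ (1 + 2 ^ e)) = 0"
    (is "\<exists>!T. ?P T")
proof
  define u where "u = x + y"
  define T where "T = {x, x + u, x + w * u, x + (w + 1) * u}"
  note neg = char_two_neg[OF two] and add_self = char_two_add_self[OF two]
  have add_eq_0: "a + b = 0 \<longleftrightarrow> a = b" for a b :: 'a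
    using neg by (metis add_eq_0_iff)
  have u: "u \<noteq> 0"
    using xy by (simp add: u_def add_eq_0)
  have y: "y = x + u"
    using add_self[of x] by (simp add: u_def flip: add.assoc)
  have w01: "w \<noteq> 0" "w \<noteq> 1" "w + 1 \<noteq> 0"
    using w add_self[of 1] by (auto simp: add_eq_0)
  have w2: "w\<^sup>2 = w + 1"
    using w by (simp add: add.assoc add_eq_0)
  \<comment> \<open>Evenness turns \<open>2 ^ e\<close> into \<open>4 ^ f\<close>, and
    \<open>w ^ 4 = w\<close>; hence \<open>w\<close> is fixed by the power
    \<open>2 ^ e\<close>.\<close>
  have "even e"
    using gcd by (metis dvd_refl gcd_nat.bounded_iff)
  then obtain f where f: "e = 2 * f" by blast
  have w4: "w ^ 4 = w"
  proof -
    have "w ^ 4 = (w\<^sup>2)\<^sup>2" by (simp flip: power_mult)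
    also have "\<dots> = w\<^sup>2 + 1"
      unfolding w2 by (simp add: power2_sum two w2)
    finally show ?thesis
      using add_self[of 1] by (simp add: w2 add.assoc)
  qed
  have we: "w ^ (2 ^ e) = w"
  proof -
    have "w ^ (4 ^ f) = w"
      by (induction f) (simp_all add: power_mult w4)
    thus ?thesis by (simp add: f power_mult)
  qed
  have plane_distinct: "w * u + u \<noteq> 0"
    using u w01 by (metis distrib_right mult_1 mult_eq_0_iff)
  have card_T: "card T = 4"
    using u w01 plane_distinct by (auto simp: T_def card_insert_if distrib_right)
  \<comment> \<open>The fourth point is regrouped so that \<open>char_two_plane_sum\<close> applies
    with \<open>v = w * u\<close>.\<close>
  have sum_T: "(\<Sum>t\<in>T. g t) = g x + g (x + u) + g (x + w * u) + g (x + u + w * u)"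
    for g :: "'a \<Rightarrow> 'a"
    using u w01 plane_distinct by (simp add: T_def distrib_right add_ac)
  show "?P T"
  proof (intro conjI)
    show "{x, y} \<subseteq> T" by (simp add: T_def y)
    have "(\<Sum>t\<in>T. t) = 2 * (2 * x + u + w * u)"
      by (simp add: sum_T[of "\<lambda>t. t"] algebra_simps)
    thus "(\<Sum>t\<in>T. t) = 0" by (simp add: two)
    show "(\<Sum>t\<in>T. t ^ (1 + 2 ^ e)) = 0"
      unfolding sum_T char_two_plane_sum[OF two]
      by (simp add: power_mult_distrib we mult_ac add_self)
  qed (fact card_T)
  fix S assume S: "?P S"
  have "card (S - {x, y}) = 2"
    using S xy by (simp add: card_Diff_subset)
  then obtain z z' where zz: "S - {x, y} = {z, z'}" "z \<noteq> z'"
    by (meson card_2_iff)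
  hence S_eq: "S = {x, y, z, z'}" and dist: "z \<noteq> x" "z \<noteq> y" "z' \<noteq> x" "z' \<noteq> y"
    using S by auto
  define v where "v = x + z"
  have z: "z = x + v"
    using add_self[of x] by (simp add: v_def flip: add.assoc)
  have sum_S: "(\<Sum>t\<in>S. g t) = g x + g y + g z + g z'" for g :: "'a \<Rightarrow> 'a"
    using dist zz xy by (simp add: S_eq add_ac)
  \<comment> \<open>The vanishing sum determines the fourth point, making \<open>S\<close> an affine
    plane over the prime field.\<close>
  have "x + y + z + z' = 0"
    using S sum_S[of "\<lambda>t. t"] by simp
  hence "z' = x + y + z"
    by (simp only: add_eq_0)
  also have "\<dots> = (x + x) + (x + u + v)"
    unfolding y z by (simp only: add_ac)
  finally have z': "z' = x + u + v"
    by (simp only: add_self add_0)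
  have v: "v \<noteq> 0" "v \<noteq> u"
    using dist(1,2) unfolding y z by simp_all
  \<comment> \<open>Dividing the remaining condition by \<open>u * u ^ (2 ^ e)\<close> leaves a
    condition on this ratio alone.\<close>
  define r where "r = v / u"
  have vr: "v = r * u" using u by (simp add: r_def)
  have "u * v ^ (2 ^ e) + u ^ (2 ^ e) * v = 0"
    using S unfolding sum_S y z z' char_two_plane_sum[OF two] by simp
  hence "u * v ^ (2 ^ e) = u ^ (2 ^ e) * v"
    by (simp only: add_eq_0)
  hence "(u * u ^ (2 ^ e)) * r ^ (2 ^ e) = (u * u ^ (2 ^ e)) * r"
    unfolding vr power_mult_distrib by (simp only: mult_ac)
  hence "r ^ (2 ^ e) = r"
    using u by simp
  \<comment> \<open>Here \<open>gcd m e = 2\<close> enters: \<open>r\<close> is fixed by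
    \<open>m\<close> and by \<open>e\<close> squarings, hence by two.\<close>
  hence "r ^ (2 ^ 2) = r"
    using frobenius_fixed_gcd[OF frob[of r]] gcd by metis
  hence "r ^ 4 + r = 0" by (simp add: add_self)
  \<comment> \<open>Factorization of \<open>r ^ 4 + r\<close> in characteristic two; the factors
    \<open>r\<close> and \<open>r + 1\<close> are excluded because the points are distinct.\<close>
  moreover have "(r\<^sup>2 + r + 1) * (r * (r + 1)) = r ^ 4 + r + 2 * (r ^ 3 + r\<^sup>2)"
    by (simp add: algebra_simps power2_eq_square power3_eq_cube power4_eq_xxxx)
  ultimately have "(r\<^sup>2 + r + 1) * (r * (r + 1)) = 0" by (simp add: two)
  moreover have "r \<noteq> 0" "r \<noteq> 1" using v u by (auto simp: r_def)
  ultimately have r: "r\<^sup>2 + r + 1 = 0" by (simp only: mult_eq_0_iff add_eq_0 simp_thms)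
  have "(r + w) * (r + (w + 1)) = (r\<^sup>2 + r + 1) + (w\<^sup>2 + w + 1) + 2 * (r * w - 1)"
    by (simp add: algebra_simps power2_eq_square)
  hence "(r + w) * (r + (w + 1)) = 0" by (simp only: r w two mult_zero_left add_0)
  hence "r = w \<or> r = w + 1" by (simp only: mult_eq_0_iff add_eq_0)
  thus "S = T"
  proof
    assume r: "r = w"
    have "x + (w + 1) * u = x + u + w * u"
      by (simp add: algebra_simps)
    thus ?thesis
      by (simp only: S_eq T_def y z z' vr r)
  next
    \<comment> \<open>This choice merely exchanges the last two points of the quadruple.\<close>
    assume r: "r = w + 1"
    have "x + u + (w + 1) * u = x + w * u + (u + u)"
      by (simp add: algebra_simps)
    hence "x + u + (w + 1) * u = x + w * u"
      by (simp only: add_self add_0_right)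
    thus ?thesis
      by (simp only: S_eq T_def y z z' vr r insert_commute)
  qed
qed

section \<open>Evaluation of binary polynomials in an extension field\<close>

lemma of_bit_add_char_two:
  assumes "(2::'a::comm_ring_1) = 0"
  shows "(of_bit (a + b) :: 'a) = of_bit a + of_bit b"
  using char_two_add_self[OF assms, of 1] by (cases a; cases b) simp_all

lemma of_bit_mult: "(of_bit (a * b) :: 'a::comm_ring_1) = of_bit a * of_bit b"
  by (cases a; cases b) simp_all

definition ext_eval :: "bit poly \<Rightarrow> 'a::comm_ring_1 \<Rightarrow> 'a" where
  "ext_eval p x = poly (map_poly of_bit p) x"

lemma ext_eval_0 [simp]: "ext_eval 0 x = 0"
  by (simp add: ext_eval_def)

lemma ext_eval_pCons [simp]: "ext_eval (pCons a p) x = of_bit a + x * ext_eval p x"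
  by (simp add: ext_eval_def map_poly_pCons)

lemma ext_eval_add:
  assumes "(2::'a::comm_ring_1) = 0"
  shows "ext_eval (p + q) (x::'a) = ext_eval p x + ext_eval q x"
  by (induction p q rule: poly_induct2)
     (simp_all add: of_bit_add_char_two[OF assms] algebra_simps assms)

lemma ext_eval_smult: "ext_eval (smult a p) x = of_bit a * ext_eval p x"
  by (induction p) (simp_all add: of_bit_mult algebra_simps)

lemma ext_eval_mult:
  assumes "(2::'a::comm_ring_1) = 0"
  shows "ext_eval (p * q) (x::'a) = ext_eval p x * ext_eval q x"
  by (induction p) (simp_all add: ext_eval_add[OF assms] ext_eval_smult algebra_simps)

lemma ext_eval_monom: "ext_eval (monom 1 n) x = x ^ n"
  by (induction n) (simp_all add: monom_Suc monom_0)

lemma ext_eval_Poly: "ext_eval (Poly c) x = (\<Sum>i<length c. of_bit (c ! i) * x ^ i)"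
  by (induction c)
     (simp_all add: sum.lessThan_Suc_shift sum_distrib_left mult.left_commute
        del: sum.lessThan_Suc sum_mult_of_bool_eq sum_of_bool_mult_eq)

lemma ext_eval_cyclic:
  assumes "(2::'a::comm_ring_1) = 0"
  shows "ext_eval (monom 1 n - 1) (x::'a) = x ^ n - 1"
proof -
  \<comment> \<open>Additivity covers only sums, so the minus sign is traded for a plus on both
    sides.\<close>
  have "ext_eval (monom 1 n + [:1:]) x = x ^ n + 1"
    by (simp add: ext_eval_add[OF assms] ext_eval_monom)
  moreover have "monom 1 n - 1 = monom (1::bit) n + [:1:]"
    by (simp add: poly_eq_iff one_pCons)
  ultimately show ?thesis
    using char_two_neg[OF assms, of 1] by (metis diff_conv_add_uminus)
qed

section \<open>Minimal polynomials and cyclic codes\<close>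

text \<open>The remainder modulo \<open>p\<close> also vanishes at \<open>\<beta>\<close> but has
  smaller degree unless it is zero.\<close>

lemma is_min_poly_dvd_iff:
  fixes \<beta> :: "'a::field"
  assumes two: "(2::'a) = 0" and p: "is_min_poly \<beta> p"
  shows "p dvd q \<longleftrightarrow> ext_eval q \<beta> = 0"
proof
  have p0: "ext_eval p \<beta> = 0" and "p \<noteq> 0"
    using p by (auto simp: is_min_poly_def ext_eval_def)
  show "ext_eval q \<beta> = 0" if "p dvd q"
    using that p0 by (auto simp: ext_eval_mult[OF two])
  assume q: "ext_eval q \<beta> = 0"
  have "ext_eval (q div p * p + q mod p) \<beta> = 0"
    using q by (simp only: div_mult_mod_eq)
  hence "ext_eval (q mod p) \<beta> = 0"
    by (simp only: ext_eval_add[OF two] ext_eval_mult[OF two] p0) simp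
  hence "degree p \<le> degree (q mod p)" if "q mod p \<noteq> 0"
    using p that unfolding is_min_poly_def ext_eval_def by blast
  moreover have "degree (q mod p) < degree p" if "q mod p \<noteq> 0"
    using \<open>p \<noteq> 0\<close> that by (rule degree_mod_less')
  ultimately have "q mod p = 0"
    using leD by blast
  thus "p dvd q"
    by (simp only: dvd_eq_mod_eq_0)
qed

text \<open>The witness \<open>p\<close> shows that \<open>\<beta>\<close> is algebraic. This is
  what makes the definite description in \<open>min_poly\<close> meaningful: a minimal polynomial
  exists and is unique.\<close>

lemma min_poly_dvd_iff:
  fixes \<beta> :: "'a::field"
  assumes two: "(2::'a) = 0" and p: "p \<noteq> 0" "ext_eval p \<beta> = 0"
  shows "min_poly \<beta> dvd q \<longleftrightarrow> ext_eval q \<beta> = 0"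
proof -
  define r where "r = arg_min degree (\<lambda>q. q \<noteq> 0 \<and> ext_eval q \<beta> = 0)"
  have r: "r \<noteq> 0 \<and> ext_eval r \<beta> = 0" "\<And>q. q \<noteq> 0 \<and> ext_eval q \<beta> = 0 \<Longrightarrow> degree r \<le> degree q"
    using arg_min_nat_lemma[of "\<lambda>q. q \<noteq> 0 \<and> ext_eval q \<beta> = 0" p degree] p by (auto simp: r_def)
  \<comment> \<open>The only nonzero scalar of the prime field is 1, so a polynomial of least degree
    is already monic.\<close>
  have "lead_coeff r = 1"
    using r by (metis bit_not_one_iff leading_coeff_0_iff)
  hence "is_min_poly \<beta> r"
    using r by (auto simp: is_min_poly_def ext_eval_def)
  moreover have "r' = r" if "is_min_poly \<beta> r'" for r'
  proof -
    have "r' dvd r" "r dvd r'"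
      using is_min_poly_dvd_iff[OF two] that \<open>is_min_poly \<beta> r\<close>
      by (auto simp: is_min_poly_def ext_eval_def)
    hence "normalize r' = normalize r"
      by (rule associatedI)
    \<comment> \<open>Mutual divisibility gives equality only up to units; monic polynomials are
      their own normal forms.\<close>
    moreover have "normalize p = p" if "is_min_poly \<beta> p" for p
      using that
      by (intro poly_eqI) (auto simp: is_min_poly_def normalize_poly_eq_map_poly coeff_map_poly)
    ultimately show ?thesis
      using that \<open>is_min_poly \<beta> r\<close> by metis
  qed
  ultimately have "is_min_poly \<beta> (min_poly \<beta>)"
    unfolding min_poly_def by (rule theI)
  thus ?thesis
    by (rule is_min_poly_dvd_iff[OF two])
qed

text \<open>A multiple of \<open>g\<close> is the modulus, so reducing modulo it does not affect
  divisibility by \<open>g\<close>.\<close>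

lemma mem_cyclic_code_iff_dvd:
  assumes "g dvd monom 1 n - 1"
  shows "c \<in> cyclic_code n g \<longleftrightarrow> length c = n \<and> g dvd Poly c"
proof -
  have "(\<exists>a. [Poly c = a * g] (mod (monom 1 n - 1))) \<longleftrightarrow> g dvd Poly c"
  proof
    assume "\<exists>a. [Poly c = a * g] (mod (monom 1 n - 1))"
    then obtain a where "[Poly c = a * g] (mod g)"
      using assms cong_dvd_modulus by blast
    thus "g dvd Poly c"
      using cong_dvd_iff dvd_triv_right by blast
  next
    assume "g dvd Poly c"
    thus "\<exists>a. [Poly c = a * g] (mod (monom 1 n - 1))"
      by (metis cong_refl dvdE mult.commute)
  qed
  thus ?thesis by (simp add: cyclic_code_def)
qed

text \<open>Divisibility by the lcm splits into two root conditions. The polynomial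
  \<open>monom 1 n - 1\<close> vanishes at both roots, so it witnesses algebraicity and is itself
  divisible by the generator.\<close>

lemma mem_cyclic_code_lcm_min_poly_iff:
  fixes \<beta> \<gamma> :: "'a::field"
  assumes two: "(2::'a) = 0" and "n > 0" and "\<beta> ^ n = 1" and "\<gamma> ^ n = 1"
  shows "c \<in> cyclic_code n (lcm (min_poly \<beta>) (min_poly \<gamma>)) \<longleftrightarrow>
           length c = n \<and> ext_eval (Poly c) \<beta> = 0 \<and> ext_eval (Poly c) \<gamma> = 0"
proof -
  have "coeff (monom 1 n - 1 :: bit poly) n = 1"
    using \<open>n > 0\<close> by (cases n) (simp_all add: one_pCons)
  hence nz: "monom 1 n - 1 \<noteq> (0 :: bit poly)"
    by (metis coeff_0 zero_neq_one)
  have ev: "ext_eval (monom 1 n - 1) \<beta> = 0" "ext_eval (monom 1 n - 1) \<gamma> = 0"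
    using assms by (simp_all add: ext_eval_cyclic[OF two])
  note iff = min_poly_dvd_iff[OF two nz ev(1)] min_poly_dvd_iff[OF two nz ev(2)]
  show ?thesis
    by (subst mem_cyclic_code_iff_dvd) (simp_all add: iff ev)
qed

section \<open>Supports of words in the extended code\<close>

lemma sum_list_eq_of_nat_card_support: "sum_list c = of_nat (card (support c))" for c :: "bit list"
proof -
  have "sum_list c = (\<Sum>i<length c. c ! i)"
    by (simp add: sum_list_sum_nth atLeast0LessThan)
  also have "\<dots> = (\<Sum>i\<in>support c. c ! i)"
    by (rule sum.mono_neutral_right) (auto simp: support_def)
  also have "\<dots> = (\<Sum>i\<in>support c. 1)"
    by (rule sum.cong) (auto simp: support_def)
  finally show ?thesis by simp
qed

lemma ext_eval_Poly_support: "ext_eval (Poly c) x = (\<Sum>i\<in>support c. x ^ i)"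
proof -
  have "ext_eval (Poly c) x = (\<Sum>i\<in>support c. of_bit (c ! i) * x ^ i)"
    unfolding ext_eval_Poly by (rule sum.mono_neutral_right) (auto simp: support_def)
  also have "\<dots> = (\<Sum>i\<in>support c. x ^ i)"
    by (rule sum.cong) (auto simp: support_def)
  finally show ?thesis .
qed

lemma support_snoc: "support (c @ [b]) = support c \<union> (if b = 0 then {} else {length c})"
  by (auto simp: support_def nth_append less_Suc_eq)

text \<open>
  The coordinates of the extended code are labelled by the field elements: $i < n$ stands for
  $\alpha^i$ and the parity coordinate $n$ for $0$, which does not contribute to power sums.
\<close>

definition coord_point :: "nat \<Rightarrow> 'a::field \<Rightarrow> nat \<Rightarrow> 'a" where
  "coord_point n \<alpha> i = (if i < n then \<alpha> ^ i else 0)"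

text \<open>Root conditions on a binary word are power sums over its support. Conversely, a set of
  even size is recovered from its part below \<open>n\<close>, since the parity bit restores
  membership of \<open>n\<close>.\<close>

lemma extended_code_supports:
  fixes \<alpha> :: "'a::field"
  assumes two: "(2::'a) = 0" and n: "n > 0" and \<alpha>: "\<alpha> ^ n = 1" and k: "k > 0"
  shows "{support c | c.
            c \<in> extended_code (cyclic_code n (lcm (min_poly \<alpha>) (min_poly (\<alpha> ^ k)))) \<and>
            hamming_weight c = 4}
       = {S. S \<subseteq> {..n} \<and> card S = 4 \<and> (\<Sum>i\<in>S. coord_point n \<alpha> i) = 0 \<and>
             (\<Sum>i\<in>S. coord_point n \<alpha> i ^ k) = 0}"
    (is "?L = ?R")
proof -
  have \<alpha>k: "(\<alpha> ^ k) ^ n = 1"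
    using \<alpha> by (metis power_mult mult.commute power_one)
  note mem = mem_cyclic_code_lcm_min_poly_iff[OF two n \<alpha> \<alpha>k]
  \<comment> \<open>Positivity of \<open>j\<close> matters: with \<open>0 ^ 0 = 1\<close> the parity
    coordinate would contribute.\<close>
  have sums: "(\<Sum>i\<in>S. coord_point n \<alpha> i ^ j) = (\<Sum>i\<in>S \<inter> {..<n}. (\<alpha> ^ j) ^ i)"
    if "S \<subseteq> {..n}" "j > 0" for S j
  proof -
    have "finite S" using that finite_subset by blast
    have "(\<Sum>i\<in>S. coord_point n \<alpha> i ^ j) = (\<Sum>i\<in>S \<inter> {..<n}. coord_point n \<alpha> i ^ j)"
      by (rule sum.mono_neutral_right)
         (use that \<open>finite S\<close> in \<open>auto simp: coord_point_def power_0_left\<close>)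
    also have "\<dots> = (\<Sum>i\<in>S \<inter> {..<n}. (\<alpha> ^ j) ^ i)"
      by (rule sum.cong) (auto simp: coord_point_def mult.commute simp flip: power_mult)
    finally show ?thesis .
  qed
  have sums1: "(\<Sum>i\<in>S. coord_point n \<alpha> i) = (\<Sum>i\<in>S \<inter> {..<n}. \<alpha> ^ i)" if "S \<subseteq> {..n}" for S
    using sums[OF that, of 1] by simp
  have supp: "support (c @ [b]) \<subseteq> {..n}" "support (c @ [b]) \<inter> {..<n} = support c"
    if "length c = n" for c :: "bit list" and b
    using that by (auto simp: support_def nth_append)
  show ?thesis
  proof (intro equalityI subsetI)
    fix S assume "S \<in> ?L"
    then obtain c where "length c = n" and S: "S = support (c @ [sum_list c])" "card S = 4"
      and ev: "ext_eval (Poly c) \<alpha> = 0" "ext_eval (Poly c) (\<alpha> ^ k) = 0"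
      by (auto simp: extended_code_def mem hamming_weight_def)
    thus "S \<in> ?R"
      using supp[OF \<open>length c = n\<close>] k by (simp add: sums sums1 ext_eval_Poly_support)
  next
    fix S assume S: "S \<in> ?R"
    define c where "c = map (\<lambda>i. of_bool (i \<in> S) :: bit) [0..<n]"
    have len: "length c = n" and supp_c: "support c = S \<inter> {..<n}"
      by (auto simp: c_def support_def)
    have S_eq: "S = support c \<union> (if n \<in> S then {n} else {})"
      using S by (auto simp: supp_c order.order_iff_strict)
    have "card S = card (support c) + (if n \<in> S then 1 else 0)"
      by (subst S_eq) (simp add: supp_c)
    \<comment> \<open>The weight of \<open>c\<close> is odd exactly when \<open>n\<close> lies in
      \<open>S\<close>, so its parity bit is the right one.\<close>
    hence "card (support c) = (if n \<in> S then 3 else 4)"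
      using S by (auto split: if_splits)
    hence "sum_list c = (if n \<in> S then 1 else 0)"
      by (simp add: sum_list_eq_of_nat_card_support)
    hence "support (c @ [sum_list c]) = support c \<union> (if n \<in> S then {n} else {})"
      by (simp add: support_snoc len)
    hence "support (c @ [sum_list c]) = S"
      using S_eq by (simp only:)
    moreover have "c \<in> cyclic_code n (lcm (min_poly \<alpha>) (min_poly (\<alpha> ^ k)))"
      using S k sums[of S k] sums1[of S] by (simp add: mem len ext_eval_Poly_support supp_c)
    ultimately show "S \<in> ?L"
      using S by (force simp: extended_code_def hamming_weight_def)
  qed
qed

section \<open>Transfer to the field and the design property\<close>

lemma coord_point_bij_betw:
  fixes \<alpha> :: "'a::{field,finite}"
  assumes "generates_units \<alpha>" and "n = CARD('a) - 1"
  shows "bij_betw (coord_point n \<alpha>) {..n} UNIV"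
proof -
  have "bij_betw (coord_point n \<alpha>) {..<n} (UNIV - {0})"
    using generator_bij_betw[OF assms(1)]
    by (subst bij_betw_cong[where g = "\<lambda>i. \<alpha> ^ i"]) (auto simp: coord_point_def assms(2))
  hence "bij_betw (coord_point n \<alpha>) ({..<n} \<union> {n}) ((UNIV - {0}) \<union> {0})"
    by (rule bij_betw_combine) (auto simp: coord_point_def bij_betw_def)
  moreover have "{..<n} \<union> {n} = {..n}" "(UNIV - {0}) \<union> {0} = (UNIV :: 'a set)" by auto
  ultimately show ?thesis by simp
qed

text \<open>For even \<open>m\<close> the order \<open>2 ^ m - 1\<close> of the unit group is
  divisible by 3, so \<open>\<alpha>\<close> raised to a third of this order is a nontrivial cube
  root of unity.\<close>

lemma primitive_cube_root_exists:
  fixes \<alpha> :: "'a::{field,finite}"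
  assumes "generates_units \<alpha>" and "even m" and "m > 0" and "CARD('a) = 2 ^ m"
  shows "\<exists>w::'a. w\<^sup>2 + w + 1 = 0"
proof -
  define n where "n = CARD('a) - 1"
  obtain f where f: "m = 2 * f" using \<open>even m\<close> by blast
  have "[4 ^ f = 1 ^ f] (mod (3::nat))"
    by (rule cong_pow) (simp add: cong_def)
  hence "3 dvd (4 ^ f - 1 :: nat)"
    by (intro cong_to_1_nat) simp
  hence "3 dvd n"
    by (simp add: n_def assms(4) f power_mult)
  then obtain d where d: "n = 3 * d" by blast
  have "(4::nat) ^ 1 \<le> 4 ^ f"
    using \<open>m > 0\<close> f by (intro power_increasing) auto
  hence "n > 0"
    by (simp add: n_def assms(4) f power_mult)
  have bij: "bij_betw (\<lambda>i. \<alpha> ^ i) {..<n} (UNIV - {0})"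
    using generator_bij_betw[OF assms(1)] by (simp add: n_def)
  have "\<alpha> \<noteq> 0"
    using assms(1) by (rule generates_units_nonzero)
  define w where "w = \<alpha> ^ d"
  have "w ^ 3 = 1"
    using power_card_minus_one[OF \<open>\<alpha> \<noteq> 0\<close>] d by (simp add: w_def n_def mult.commute flip: power_mult)
  hence "(w - 1) * (w\<^sup>2 + w + 1) = 0"
    by (simp add: algebra_simps power2_eq_square power3_eq_cube)
  moreover have "w \<noteq> 1"
    using bij_betw_imp_inj_on[OF bij] inj_onD[of "\<lambda>i. \<alpha> ^ i" "{..<n}" d 0] d \<open>n > 0\<close>
    by (auto simp: w_def)
  ultimately show ?thesis by auto
qed

theorem theorem3p8:
  fixes m e :: nat and \<alpha> :: "'a::{field,finite}"
  assumes "m \<ge> 4" and "even m"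
    and "2 \<le> e" and "e \<le> m div 2" and "gcd m e = 2"
    and "CARD('a) = 2 ^ m"
    and "generates_units \<alpha>"
  shows "two_design (2 ^ m) 4 1 {0..<2 ^ m}
           {support c | c.
              c \<in> extended_code (cyclic_code (2 ^ m - 1)
                     (lcm (min_poly \<alpha>) (min_poly (\<alpha> ^ (1 + 2 ^ e))))) \<and>
              hamming_weight c = 4}"
proof -
  define n :: nat where "n = 2 ^ m - 1"
  define pt where "pt = coord_point n \<alpha>"
  have n_card: "n = CARD('a) - 1" by (simp add: n_def assms(6))
  have two: "(2::'a) = 0" using assms(6) by (rule two_eq_zero_of_card)
  have "(2::nat) ^ 1 \<le> 2 ^ m"
    using assms(1) by (intro power_increasing) auto
  hence n: "n > 0" and V: "{0..<2 ^ m} = {..n}" by (auto simp: n_def)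
  have bij: "bij_betw pt {..n} UNIV"
    unfolding pt_def using assms(7) n_card by (rule coord_point_bij_betw)
  have "\<alpha> \<noteq> 0"
    using assms(7) by (rule generates_units_nonzero)
  hence \<alpha>: "\<alpha> ^ n = 1" using power_card_minus_one n_card by blast
  have frob: "z ^ (2 ^ m) = z" for z :: 'a
  proof (cases "z = 0")
    case False
    have "z ^ (2 ^ m) = z * z ^ n" by (simp add: n_def flip: power_Suc)
    also have "z ^ n = 1" using power_card_minus_one[OF False] n_card by simp
    finally show ?thesis by simp
  qed simp
  obtain w :: 'a where w: "w\<^sup>2 + w + 1 = 0"
    using primitive_cube_root_exists[OF assms(7,2) _ assms(6)] assms(1) by auto
  define \<B> where "\<B> = {S. S \<subseteq> {..n} \<and> card S = 4 \<and> (\<Sum>i\<in>S. pt i) = 0 \<and>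
    (\<Sum>i\<in>S. pt i ^ (1 + 2 ^ e)) = 0}"
  have blocks: "{support c | c.
      c \<in> extended_code (cyclic_code n (lcm (min_poly \<alpha>) (min_poly (\<alpha> ^ (1 + 2 ^ e))))) \<and>
      hamming_weight c = 4} = \<B>"
    unfolding \<B>_def pt_def by (rule extended_code_supports[OF two n \<alpha>]) simp
  have "card {B \<in> \<B>. P \<subseteq> B} = 1" if P: "P \<subseteq> {..n}" "card P = 2" for P
  proof -
    obtain i j where ij: "P = {i, j}" "i \<noteq> j" using P by (auto simp: card_2_iff)
    have inj: "inj_on pt {..n}" using bij by (rule bij_betw_imp_inj_on)
    have "pt i \<noteq> pt j" using inj_onD[OF inj, of i j] ij P by auto
    from char_two_quadruple_unique[OF two frob assms(5) w this]
    have ex1: "\<exists>!T. card T = 4 \<and> {pt i, pt j} \<subseteq> T \<and> (\<Sum>t\<in>T. t) = 0 \<and>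
      (\<Sum>t\<in>T. t ^ (1 + 2 ^ e)) = 0" (is "\<exists>!T. ?Q T") .
    \<comment> \<open>Blocks through \<open>P\<close> correspond under the labelling
      \<open>pt\<close> to the quadruples of field elements counted by \<open>ex1\<close>.\<close>
    have trans: "B \<in> \<B> \<and> P \<subseteq> B \<longleftrightarrow> ?Q (pt ` B)" if B: "B \<subseteq> {..n}" for B
    proof -
      have injB: "inj_on pt B" using inj B by (rule inj_on_subset)
      have "P \<subseteq> B \<longleftrightarrow> {pt i, pt j} \<subseteq> pt ` B"
        using inj_on_image_mem_iff[OF inj] B P ij by auto
      thus ?thesis
        using B by (auto simp: \<B>_def card_image[OF injB] sum.reindex[OF injB])
    qed
    obtain T where T: "?Q T" "\<forall>T'. ?Q T' \<longrightarrow> T' = T"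
      using ex1 by (elim ex1E) (rule that)
    \<comment> \<open>Surjectivity of \<open>pt\<close> pulls the unique quadruple back to a block;
      injectivity then makes that block unique.\<close>
    obtain B where B: "B \<subseteq> {..n}" "pt ` B = T"
      using bij by (metis bij_betw_imp_surj_on subset_UNIV subset_image_iff)
    have "{B \<in> \<B>. P \<subseteq> B} = {B}"
    proof (intro equalityI subsetI)
      fix B' assume B': "B' \<in> {B \<in> \<B>. P \<subseteq> B}"
      hence sub: "B' \<subseteq> {..n}" by (simp add: \<B>_def)
      have "?Q (pt ` B')" using B' trans[OF sub] by simp
      hence "pt ` B' = T" by (rule T(2)[rule_format])
      hence "pt ` B' = pt ` B" using B(2) by simp
      thus "B' \<in> {B}" using inj_on_image_eq_iff[OF inj sub B(1)] by simp
    next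
      fix B' assume "B' \<in> {B}"
      thus "B' \<in> {B \<in> \<B>. P \<subseteq> B}" using trans[OF B(1)] T(1) B(2) by auto
    qed
    thus ?thesis by simp
  qed
  moreover have "B \<subseteq> {..n} \<and> card B = 4" if "B \<in> \<B>" for B
    using that by (simp add: \<B>_def)
  moreover have "card {..n} = 2 ^ m" using V by (metis card_atLeastLessThan diff_zero)
  ultimately show ?thesis
    unfolding two_design_def V n_def[symmetric] blocks by auto
qed

end
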